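(* Let $n\geq 1$ and $j\geq 0$ be integers. Then $$HC\left(n,j+1,0,j+\tfrac12,2n(2j+1);x\right)=(-n)^{-j}\binom{2j}{j}^{-1}K_n^{(j)}(x),$$ where $K_n^{(j)}$ denotes the $j$-th derivative of $K_n$.
   Context: For $p\neq 0$, the confluent Heun function $HC(p,\gamma,\delta,\alpha,\sigma;x)$ is the solution $u(x)$, analytic at $x=0$ and normalized by $u(0)=1$, of the confluent Heun equation $$u''(x)+\left(4p+\frac{\gamma}{x}+\frac{\delta}{x-1}\right)u'(x)+\frac{4p\alpha x-\sigma}{x(x-1)}u(x)=0 .$$ The function $K_n$ is the index of coincidence of the Poisson distribution: $$K_n(x):=\sum_{k=0}^\infty\left(e^{-nx}\frac{(nx)^k}{k!}\right)^2,\qquad x\in[0,+\infty).$$ *)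

theory Defs
  imports "HOL-Complex_Analysis.Complex_Analysis"
begin

definition confluent_heun_solution ::
    "complex \<Rightarrow> complex \<Rightarrow> complex \<Rightarrow> complex \<Rightarrow> complex \<Rightarrow> complex set \<Rightarrow> (complex \<Rightarrow> complex) \<Rightarrow> bool"
  where
  "confluent_heun_solution p \<gamma> \<delta> \<alpha> \<sigma> S u \<longleftrightarrow>
     u holomorphic_on S \<and>
     (\<forall>x \<in> S - {0, 1}.
        deriv (deriv u) x + (4 * p + \<gamma> / x + \<delta> / (x - 1)) * deriv u x
          + (4 * p * \<alpha> * x - \<sigma>) / (x * (x - 1)) * u x = 0)"

text \<open>
  The solution analytic at the singular point \<open>0\<close> with value \<open>1\<close> there is continued
  analytically along straight segments from \<open>0\<close>, i.e. to open sets that are star-shaped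
  about \<open>0\<close>. Two such sets meet in a connected neighbourhood of \<open>0\<close>, so the value at \<open>x\<close> does
  not depend on the set as long as the solution is unique near \<open>0\<close> (\<open>\<gamma>\<close> not in
  \<open>0, -1, -2, \<dots>\<close>). In general this is the branch with cut along the real half-line from
  \<open>1\<close>; points of that half-line are covered as well when the solution extends
  holomorphically across the singular point \<open>1\<close>.
\<close>

definition HC :: "complex \<Rightarrow> complex \<Rightarrow> complex \<Rightarrow> complex \<Rightarrow> complex \<Rightarrow> complex \<Rightarrow> complex"
  where
  "HC p \<gamma> \<delta> \<alpha> \<sigma> x =
     (THE y. \<exists>S u. open S \<and> 0 \<in> S \<and> (\<forall>z\<in>S. closed_segment 0 z \<subseteq> S) \<and> x \<in> S \<and>
        confluent_heun_solution p \<gamma> \<delta> \<alpha> \<sigma> S u \<and> u 0 = 1 \<and> u x = y)"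

definition K :: "nat \<Rightarrow> real \<Rightarrow> real"
  where "K n x = (\<Sum>k. (exp (- real n * x) * (real n * x) ^ k / fact k)\<^sup>2)"

text \<open>
  The derivative of a function on \<open>[0, \<infinity>)\<close>: one-sided at \<open>0\<close>, the ordinary one elsewhere.
\<close>

definition deriv_halfline :: "(real \<Rightarrow> real) \<Rightarrow> real \<Rightarrow> real"
  where "deriv_halfline f x = vector_derivative f (at x within {0..})"

end

theory Submission
  imports Defs
begin

text \<open>
  With \<open>G(w) = (\<Sum>k. w\<^sup>k / (k!)\<^sup>2)\<close>, the index of coincidence is
  \<open>K\<^sub>n(x) = exp (-2nx) G(n\<^sup>2x\<^sup>2)\<close>, which is the restriction of an entire function to
  the half-line. The series satisfies \<open>w G'' + G' - G = 0\<close>, whence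
  \<open>z K\<^sub>n'' + (1 + 4nz) K\<^sub>n' + 2n K\<^sub>n = 0\<close>. Differentiating this \<open>j\<close> times gives
  \<open>z f'' + (j + 1 + 4nz) f' + 2n (2j + 1) f = 0\<close> for the \<open>j\<close>-th derivative \<open>f\<close> of \<open>K\<^sub>n\<close>.
  For the parameters in question the numerator \<open>4p\<alpha>x - \<sigma>\<close> is \<open>2n (2j + 1)(x - 1)\<close>, so
  the singularity at \<open>1\<close> cancels and the confluent Heun equation is exactly this equation
  divided by \<open>z\<close> (lemma \<open>confluent_heun_higher_deriv_poisson_coincidence\<close>). At \<open>z = 0\<close>
  it reads \<open>(j + 1) f'(0) = -2n (2j + 1) f(0)\<close>, so the \<open>j\<close>-th derivative of \<open>K\<^sub>n\<close> at \<open>0\<close> is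
  \<open>(-n)\<^sup>j (2j choose j)\<close>; this is the normalising constant.

  It remains that the solution is unique. If \<open>\<gamma>\<close> is not a non-positive integer, the
  Frobenius recurrence at \<open>0\<close> determines every Taylor coefficient from the preceding ones,
  so two solutions with the same value at \<open>0\<close> agree near \<open>0\<close>, and by the identity theorem
  on every connected open set (lemma \<open>confluent_heun_solution_unique\<close>).
\<close>

section \<open>Uniqueness of the solution analytic at the origin\<close>

lemma confluent_heun_solution_diff:
  assumes "open S" "confluent_heun_solution p \<gamma> \<delta> \<alpha> \<sigma> S u"
    "confluent_heun_solution p \<gamma> \<delta> \<alpha> \<sigma> S v"
  shows "confluent_heun_solution p \<gamma> \<delta> \<alpha> \<sigma> S (\<lambda>z. u z - v z)"
proof -
  have u: "u holomorphic_on S" and v: "v holomorphic_on S"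
    using assms(2,3) by (auto simp: confluent_heun_solution_def)
  have d1: "deriv (\<lambda>z. u z - v z) x = deriv u x - deriv v x" if "x \<in> S" for x
    using that u v assms(1) by (intro deriv_diff) (auto simp: holomorphic_on_imp_differentiable_at)
  have d2: "deriv (deriv (\<lambda>z. u z - v z)) x = deriv (deriv u) x - deriv (deriv v) x"
    if "x \<in> S" for x
  proof -
    have "deriv (deriv (\<lambda>z. u z - v z)) x = deriv (\<lambda>z. deriv u z - deriv v z) x"
      using assms(1) that d1 by (intro deriv_cong_ev refl) (auto intro: eventually_nhds_in_open
          elim!: eventually_mono[OF eventually_nhds_in_open])
    also have "\<dots> = deriv (deriv u) x - deriv (deriv v) x"
      using that u v assms(1)
      by (intro deriv_diff) (auto intro: holomorphic_on_imp_differentiable_at[OF holomorphic_deriv])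
    finally show ?thesis .
  qed
  have linear: "(a - a') + A * (b - b') + B * (c - c') = 0"
    if "a + A * b + B * c = 0" "a' + A * b' + B * c' = 0" for a a' b b' c c' A B :: complex
    using that by algebra
  show ?thesis
    unfolding confluent_heun_solution_def
  proof (intro conjI ballI)
    show "(\<lambda>z. u z - v z) holomorphic_on S"
      using u v by (intro holomorphic_intros)
    fix x assume x: "x \<in> S - {0, 1}"
    have "deriv (deriv u) x + (4 * p + \<gamma> / x + \<delta> / (x - 1)) * deriv u x
            + (4 * p * \<alpha> * x - \<sigma>) / (x * (x - 1)) * u x = 0"
      and "deriv (deriv v) x + (4 * p + \<gamma> / x + \<delta> / (x - 1)) * deriv v x
            + (4 * p * \<alpha> * x - \<sigma>) / (x * (x - 1)) * v x = 0"
      using x assms(2,3) unfolding confluent_heun_solution_def by blast+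
    then show "deriv (deriv (\<lambda>z. u z - v z)) x
        + (4 * p + \<gamma> / x + \<delta> / (x - 1)) * deriv (\<lambda>z. u z - v z) x
        + (4 * p * \<alpha> * x - \<sigma>) / (x * (x - 1)) * (u x - v x) = 0"
      using x d1[of x] d2[of x] by (simp only: linear Diff_iff)
  qed
qed

text \<open>
  The hypothesis \<open>eq\<close> is the confluent Heun equation multiplied by \<open>x\<^sup>2 (x - 1)\<close>. Comparing
  coefficients of \<open>x\<^sup>m\<^sup>+\<^sup>1\<close> expresses \<open>-(m + 1)(m + \<gamma>) d\<^bsub>m + 1\<^esub>\<close> through
  \<open>d\<^sub>0, \<dots>, d\<^sub>m\<close>.
\<close>
lemma confluent_heun_fps_eq_0:
  fixes D :: "complex fps"
  assumes \<gamma>: "\<gamma> \<notin> \<int>\<^sub>\<le>\<^sub>0" and D0: "fps_nth D 0 = 0"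
    and eq: "fps_X * (fps_X * (fps_X * fps_deriv (fps_deriv D) - fps_deriv (fps_deriv D)))
      + (fps_const (4 * p) * (fps_X * (fps_X * (fps_X * fps_deriv D - fps_deriv D)))
         + fps_const \<gamma> * (fps_X * (fps_X * fps_deriv D - fps_deriv D))
         + fps_const \<delta> * (fps_X * (fps_X * fps_deriv D)))
      + (fps_const (4 * p * \<alpha>) * (fps_X * (fps_X * D)) - fps_const \<sigma> * (fps_X * D)) = 0"
  shows "D = 0"
proof -
  have "fps_nth D k = 0" for k
  proof (induction k rule: less_induct)
    case (less k)
    show ?case
    proof (cases k)
      case 0
      then show ?thesis using D0 by simp
    next
      case (Suc m)
      have low: "fps_nth D i = 0" if "i \<le> m" for i
        using less Suc that by simp
      have "- of_nat (Suc m) * ((of_nat m + \<gamma>) * fps_nth D (Suc m)) = 0"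
      proof (cases m)
        case 0
        then show ?thesis
          using arg_cong[OF eq, of "\<lambda>F. fps_nth F (Suc m)"] D0 by simp
      next
        case (Suc l)
        have low': "fps_nth D i = 0" if "i \<le> Suc l" for i
          using low Suc that by simp
        note nth = fps_add_nth fps_sub_nth fps_mult_left_const_nth fps_X_mult_nth fps_deriv_nth
        have "- (of_nat (Suc l) * (of_nat (Suc (Suc l)) * fps_nth D (Suc (Suc l))))
            - \<gamma> * (of_nat (Suc (Suc l)) * fps_nth D (Suc (Suc l))) = 0"
          using arg_cong[OF eq, of "\<lambda>F. fps_nth F (Suc (Suc l))"] low' unfolding nth
          by (cases l) (simp_all del: of_nat_Suc mult_eq_0_iff)
        then show ?thesis unfolding Suc by algebra
      qed
      moreover have "of_nat m + \<gamma> \<noteq> 0"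
      proof
        assume "of_nat m + \<gamma> = 0"
        then have "\<gamma> = - of_nat m" by (simp add: add_eq_0_iff2)
        then show False using \<gamma> by simp
      qed
      moreover have "of_nat (Suc m) \<noteq> (0::complex)"
        by (simp only: of_nat_eq_0_iff)
      ultimately show ?thesis using Suc by (metis mult_eq_0_iff neg_equal_0_iff_equal)
    qed
  qed
  then show ?thesis by (simp add: fps_eq_iff)
qed

lemma confluent_heun_solution_eq_0:
  assumes S: "open S" "connected S" "0 \<in> S" and \<gamma>: "\<gamma> \<notin> \<int>\<^sub>\<le>\<^sub>0"
    and sol: "confluent_heun_solution p \<gamma> \<delta> \<alpha> \<sigma> S d" and d0: "d 0 = 0" and x: "x \<in> S"
  shows "d x = 0"
proof -
  have hol: "d holomorphic_on S"
    using sol by (simp add: confluent_heun_solution_def)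
  define D where "D = fps_expansion d 0"
  have D: "d has_fps_expansion D"
    unfolding D_def using hol S by (intro has_fps_expansion_fps_expansion)
  let ?E = "\<lambda>z. z * (z * (z * deriv (deriv d) z - deriv (deriv d) z))
      + (4 * p * (z * (z * (z * deriv d z - deriv d z)))
         + \<gamma> * (z * (z * deriv d z - deriv d z)) + \<delta> * (z * (z * deriv d z)))
      + (4 * p * \<alpha> * (z * (z * d z)) - \<sigma> * (z * d z))"
  let ?F = "fps_X * (fps_X * (fps_X * fps_deriv (fps_deriv D) - fps_deriv (fps_deriv D)))
      + (fps_const (4 * p) * (fps_X * (fps_X * (fps_X * fps_deriv D - fps_deriv D)))
         + fps_const \<gamma> * (fps_X * (fps_X * fps_deriv D - fps_deriv D))
         + fps_const \<delta> * (fps_X * (fps_X * fps_deriv D)))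
      + (fps_const (4 * p * \<alpha>) * (fps_X * (fps_X * D)) - fps_const \<sigma> * (fps_X * D))"
  have E: "?E has_fps_expansion ?F"
    by (intro fps_expansion_intros D)
  have E0: "?E z = 0" if z: "z \<in> S - {1}" for z
  proof (cases "z = 0")
    case True
    \<comment> \<open>The cleared equation has a factor \<open>z\<close> in every term.\<close>
    then show ?thesis by simp
  next
    case False
    then have z1: "z - 1 \<noteq> 0" using z by auto
    have "deriv (deriv d) z + (4 * p + \<gamma> / z + \<delta> / (z - 1)) * deriv d z
        + (4 * p * \<alpha> * z - \<sigma>) / (z * (z - 1)) * d z = 0"
      using sol z False by (auto simp: confluent_heun_solution_def)
    moreover have "?E z = z ^ 2 * (z - 1) * (deriv (deriv d) z
        + (4 * p + \<gamma> / z + \<delta> / (z - 1)) * deriv d z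
        + (4 * p * \<alpha> * z - \<sigma>) / (z * (z - 1)) * d z)"
      using False z1 by (simp add: divide_simps power2_eq_square) (simp add: algebra_simps)
    ultimately show ?thesis by simp
  qed
  have ev: "eventually (\<lambda>z. z \<in> S - {1}) (nhds 0)"
    using S by (intro eventually_nhds_in_open open_delete) auto
  have "eventually (\<lambda>z. ?E z = 0) (nhds 0)"
    using ev by eventually_elim (rule E0)
  then have "(\<lambda>_. 0) has_fps_expansion ?F"
    using has_fps_expansion_cong[where f = ?E and g = "\<lambda>_. 0", OF _ refl, THEN iffD1, OF _ E]
    by blast
  then have "?F = 0"
    using fps_expansion_unique_complex has_fps_expansion_0 by blast
  moreover have "fps_nth D 0 = 0"
    using has_fps_expansion_imp_0_eq_fps_nth_0[OF D] d0 by simp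
  ultimately have "D = 0"
    using confluent_heun_fps_eq_0[OF \<gamma>] by blast
  then show ?thesis
    using has_fps_expansion_0_analytic_continuation[OF _ hol S x] D by simp
qed

lemma confluent_heun_solution_unique:
  assumes S: "open S" "connected S" "0 \<in> S" and "\<gamma> \<notin> \<int>\<^sub>\<le>\<^sub>0"
    and u: "confluent_heun_solution p \<gamma> \<delta> \<alpha> \<sigma> S u"
    and v: "confluent_heun_solution p \<gamma> \<delta> \<alpha> \<sigma> S v"
    and "u 0 = v 0" and "x \<in> S"
  shows "u x = v x"
  using confluent_heun_solution_eq_0[OF S assms(4) confluent_heun_solution_diff[OF S(1) u v]]
    assms(7,8) by simp

lemma HC_eq_entire_solution:
  assumes "\<gamma> \<notin> \<int>\<^sub>\<le>\<^sub>0" and u: "confluent_heun_solution p \<gamma> \<delta> \<alpha> \<sigma> UNIV u" and "u 0 = 1"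
  shows "HC p \<gamma> \<delta> \<alpha> \<sigma> x = u x"
  unfolding HC_def
proof (rule the_equality)
  show "\<exists>S v. open S \<and> 0 \<in> S \<and> (\<forall>z\<in>S. closed_segment 0 z \<subseteq> S) \<and> x \<in> S \<and>
      confluent_heun_solution p \<gamma> \<delta> \<alpha> \<sigma> S v \<and> v 0 = 1 \<and> v x = u x"
    using u assms(3) by (intro exI[of _ UNIV] exI[of _ u]) auto
  fix y
  assume "\<exists>S v. open S \<and> 0 \<in> S \<and> (\<forall>z\<in>S. closed_segment 0 z \<subseteq> S) \<and> x \<in> S \<and>
      confluent_heun_solution p \<gamma> \<delta> \<alpha> \<sigma> S v \<and> v 0 = 1 \<and> v x = y"
  then obtain S v where S: "open S" "0 \<in> S" "\<forall>z\<in>S. closed_segment 0 z \<subseteq> S" "x \<in> S"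
    and v: "confluent_heun_solution p \<gamma> \<delta> \<alpha> \<sigma> S v" "v 0 = 1" "v x = y" by blast
  have "starlike S" using S by (auto simp: starlike_def)
  then have "connected S" by (rule starlike_imp_connected)
  moreover have "confluent_heun_solution p \<gamma> \<delta> \<alpha> \<sigma> S u"
    using u by (auto simp: confluent_heun_solution_def intro: holomorphic_on_subset)
  ultimately show "y = u x"
    using confluent_heun_solution_unique[of S \<gamma> p \<delta> \<alpha> \<sigma> v u x] S v assms(1,3) by simp
qed

section \<open>The entire extension of the index of coincidence\<close>

text \<open>The power series \<open>\<Sum>k. w\<^sup>k / (k!)\<^sup>2\<close>.\<close>
definition inv_fact_sq_fps :: "complex fps"
  where "inv_fact_sq_fps = Abs_fps (\<lambda>k. 1 / (fact k)\<^sup>2)"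

text \<open>
  Its sum, an entire function \<open>G\<close>; the modified Bessel function is \<open>I\<^sub>0(z) = G(z\<^sup>2 / 4)\<close>.
  Its derivatives are written as evaluations of the differentiated series.
\<close>
definition inv_fact_sq_fun :: "complex \<Rightarrow> complex"
  where "inv_fact_sq_fun = eval_fps inv_fact_sq_fps"

lemma fps_conv_radius_inv_fact_sq_fps [simp]: "fps_conv_radius inv_fact_sq_fps = \<infinity>"
proof -
  have "conv_radius (\<lambda>k. 1 / (fact k)\<^sup>2 :: complex) = \<infinity>"
  proof (rule conv_radius_inftyI'')
    fix z :: complex
    have "summable (\<lambda>k. norm z ^ k / fact k)"
      using summable_exp[of "norm z"] by (simp add: field_simps)
    moreover have "norm (1 / (fact k)\<^sup>2 * z ^ k) \<le> norm z ^ k / fact k" for k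
      using fact_ge_1[of k, where 'a = real]
      by (auto simp: norm_mult norm_divide norm_power power2_eq_square intro!: divide_left_mono)
    ultimately show "summable (\<lambda>k. 1 / (fact k)\<^sup>2 * z ^ k)"
      by (blast intro: summable_comparison_test')
  qed
  then show ?thesis by (simp add: fps_conv_radius_def inv_fact_sq_fps_def)
qed

lemma fps_conv_radius_fps_deriv_eq_infinity:
  fixes f :: "'a :: {banach, real_normed_field} fps"
  shows "fps_conv_radius f = \<infinity> \<Longrightarrow> fps_conv_radius (fps_deriv f) = \<infinity>"
  using fps_conv_radius_deriv[of f] by simp

lemma inv_fact_sq_fps_ode:
  "fps_X * fps_deriv (fps_deriv inv_fact_sq_fps) + fps_deriv inv_fact_sq_fps = inv_fact_sq_fps"
proof (rule fps_ext)
  fix k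
  have *: "(1 + of_nat k) * (1 + of_nat k) / (fact (Suc k))\<^sup>2 = (1 / (fact k)\<^sup>2 :: complex)"
  proof -
    have "(1 + of_nat k :: complex) \<noteq> 0" by (metis of_nat_Suc of_nat_neq_0)
    then show ?thesis by (simp add: power2_eq_square)
  qed
  show "fps_nth (fps_X * fps_deriv (fps_deriv inv_fact_sq_fps) + fps_deriv inv_fact_sq_fps) k
      = fps_nth inv_fact_sq_fps k"
    unfolding inv_fact_sq_fps_def using *
    by (cases k) (auto simp del: fact_Suc simp: algebra_simps add_divide_distrib)
qed

lemma DERIV_inv_fact_sq_fun:
  "(inv_fact_sq_fun has_field_derivative eval_fps (fps_deriv inv_fact_sq_fps) z) (at z within A)"
  unfolding inv_fact_sq_fun_def by (rule has_field_derivative_eval_fps) simp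

lemma DERIV_deriv_inv_fact_sq_fun:
  "(eval_fps (fps_deriv inv_fact_sq_fps) has_field_derivative
     eval_fps (fps_deriv (fps_deriv inv_fact_sq_fps)) z) (at z within A)"
  by (rule has_field_derivative_eval_fps) (simp add: fps_conv_radius_fps_deriv_eq_infinity)

lemma inv_fact_sq_fun_ode:
  "w * eval_fps (fps_deriv (fps_deriv inv_fact_sq_fps)) w
     + eval_fps (fps_deriv inv_fact_sq_fps) w = inv_fact_sq_fun w"
proof -
  note [simp] = fps_conv_radius_fps_deriv_eq_infinity
  have "eval_fps (fps_X * fps_deriv (fps_deriv inv_fact_sq_fps) + fps_deriv inv_fact_sq_fps) w
      = w * eval_fps (fps_deriv (fps_deriv inv_fact_sq_fps)) w
         + eval_fps (fps_deriv inv_fact_sq_fps) w"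
  proof -
    have "fps_conv_radius (fps_X * fps_deriv (fps_deriv inv_fact_sq_fps)) = \<infinity>"
      using fps_conv_radius_mult[of fps_X "fps_deriv (fps_deriv inv_fact_sq_fps)"] by simp
    then show ?thesis by (simp add: eval_fps_add eval_fps_mult)
  qed
  then show ?thesis unfolding inv_fact_sq_fps_ode inv_fact_sq_fun_def by simp
qed

text \<open>
  The entire function extending \<open>K n\<close>, in the closed form
  \<open>exp (-2nz) I\<^sub>0(2nz) = exp (-2nz) (\<Sum>k. (nz)\<^sup>2\<^sup>k / (k!)\<^sup>2)\<close>.
\<close>
definition poisson_coincidence :: "nat \<Rightarrow> complex \<Rightarrow> complex"
  where "poisson_coincidence n z = exp (- 2 * of_nat n * z) * inv_fact_sq_fun ((of_nat n * z)\<^sup>2)"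

lemma poisson_coincidence_of_real:
  "poisson_coincidence n (of_real x) = of_real (K n x)"
proof -
  let ?e = "exp (- 2 * real n * x)"
  have summand: "(exp (- real n * x) * (real n * x) ^ k / fact k)\<^sup>2
      = ?e * (((real n * x)\<^sup>2) ^ k / (fact k)\<^sup>2)" for k
  proof -
    have "?e = (exp (- real n * x))\<^sup>2"
      by (simp add: power2_eq_square flip: exp_add)
    then show ?thesis
      by (simp add: power_mult_distrib power_divide power_mult[symmetric] mult.commute)
  qed
  have "(\<lambda>k. fps_nth inv_fact_sq_fps k * ((of_nat n * of_real x)\<^sup>2) ^ k)
      sums inv_fact_sq_fun ((of_nat n * of_real x)\<^sup>2)"
    unfolding inv_fact_sq_fun_def by (rule sums_eval_fps) simp
  then have "(\<lambda>k. complex_of_real (((real n * x)\<^sup>2) ^ k / (fact k)\<^sup>2))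
      sums inv_fact_sq_fun ((of_nat n * of_real x)\<^sup>2)"
    by (simp add: inv_fact_sq_fps_def)
  from sums_mult[OF this, of "of_real ?e"]
  have "(\<lambda>k. complex_of_real ((exp (- real n * x) * (real n * x) ^ k / fact k)\<^sup>2))
      sums (of_real ?e * inv_fact_sq_fun ((of_nat n * of_real x)\<^sup>2))"
    unfolding summand by simp
  moreover have "of_real ?e * inv_fact_sq_fun ((of_nat n * of_real x)\<^sup>2)
      = poisson_coincidence n (of_real x)"
    by (simp add: poisson_coincidence_def exp_of_real[symmetric])
  ultimately have s: "(\<lambda>k. complex_of_real ((exp (- real n * x) * (real n * x) ^ k / fact k)\<^sup>2))
      sums poisson_coincidence n (of_real x)" by simp
  then have "summable (\<lambda>k. (exp (- real n * x) * (real n * x) ^ k / fact k)\<^sup>2)"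
    using sums_summable summable_complex_of_real by blast
  then have "(\<lambda>k. complex_of_real ((exp (- real n * x) * (real n * x) ^ k / fact k)\<^sup>2))
      sums of_real (K n x)"
    unfolding K_def by (intro sums_of_real summable_sums)
  with s show ?thesis by (rule sums_unique2)
qed

section \<open>The differential equation for the derivatives\<close>

lemma poisson_coincidence_ode:
  fixes z :: complex
  shows "z * deriv (deriv (poisson_coincidence n)) z
    + (1 + 4 * of_nat n * z) * deriv (poisson_coincidence n) z
    + 2 * of_nat n * poisson_coincidence n z = 0"
proof -
  define N where "N = complex_of_nat n"
  define e where "e = (\<lambda>z. exp (- 2 * N * z))"
  define G where "G = (\<lambda>z. inv_fact_sq_fun ((N * z)\<^sup>2))"
  define G1 where "G1 = (\<lambda>z. eval_fps (fps_deriv inv_fact_sq_fps) ((N * z)\<^sup>2))"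
  define G2 where "G2 = (\<lambda>z. eval_fps (fps_deriv (fps_deriv inv_fact_sq_fps)) ((N * z)\<^sup>2))"
  have e: "(e has_field_derivative - 2 * N * e z) (at z)" for z
    unfolding e_def by (auto intro!: derivative_eq_intros)
  have sq: "((\<lambda>z. (N * z)\<^sup>2) has_field_derivative 2 * N\<^sup>2 * z) (at z)" for z
    by (auto intro!: derivative_eq_intros simp: power2_eq_square)
  have G: "(G has_field_derivative 2 * N\<^sup>2 * z * G1 z) (at z)" for z
    unfolding G_def G1_def
    using DERIV_chain2[OF DERIV_inv_fact_sq_fun[of "(N * z)\<^sup>2" UNIV] sq] by (simp add: mult_ac)
  have G1: "(G1 has_field_derivative 2 * N\<^sup>2 * z * G2 z) (at z)" for z
    unfolding G1_def G2_def
    using DERIV_chain2[OF DERIV_deriv_inv_fact_sq_fun[of "(N * z)\<^sup>2" UNIV] sq]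
    by (simp add: mult_ac)
  have K0: "poisson_coincidence n = (\<lambda>z. e z * G z)"
    by (auto simp: poisson_coincidence_def e_def G_def N_def)
  have K1: "deriv (poisson_coincidence n) = (\<lambda>z. e z * (2 * N\<^sup>2 * z * G1 z - 2 * N * G z))"
    unfolding K0
    by (rule ext, rule DERIV_imp_deriv)
      (rule derivative_eq_intros e G refl | simp add: algebra_simps)+
  have K2: "deriv (deriv (poisson_coincidence n)) z = e z * (4 * N\<^sup>2 * G z - 8 * N ^ 3 * z * G1 z
      + 2 * N\<^sup>2 * G1 z + 4 * N ^ 4 * z\<^sup>2 * G2 z)"
    unfolding K1
    by (rule DERIV_imp_deriv)
      (rule derivative_eq_intros e G G1 refl
        | simp add: algebra_simps power2_eq_square power3_eq_cube power4_eq_xxxx)+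
  have "z * deriv (deriv (poisson_coincidence n)) z
      + (1 + 4 * N * z) * deriv (poisson_coincidence n) z + 2 * N * poisson_coincidence n z
      = 4 * N\<^sup>2 * z * e z * ((N * z)\<^sup>2 * G2 z + G1 z - G z)"
    unfolding K2 unfolding K1 unfolding K0
    by (simp add: algebra_simps power2_eq_square power3_eq_cube power4_eq_xxxx)
  also have "\<dots> = 0"
    using inv_fact_sq_fun_ode[of "(N * z)\<^sup>2"] by (simp add: G_def G1_def G2_def)
  finally show ?thesis by (simp add: N_def)
qed

lemma holomorphic_poisson_coincidence: "poisson_coincidence n holomorphic_on A"
proof -
  have "inv_fact_sq_fun holomorphic_on UNIV"
    using DERIV_inv_fact_sq_fun by (auto simp: holomorphic_on_def field_differentiable_def)
  then have "(\<lambda>z. inv_fact_sq_fun ((of_nat n * z)\<^sup>2)) holomorphic_on A"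
    by (rule holomorphic_on_compose_gen[of _ A _ UNIV, unfolded o_def, rotated])
      (auto intro!: holomorphic_intros)
  then show ?thesis
    unfolding poisson_coincidence_def[abs_def] by (intro holomorphic_intros)
qed

lemma DERIV_higher_deriv_poisson_coincidence:
  "((deriv ^^ j) (poisson_coincidence n) has_field_derivative
     (deriv ^^ Suc j) (poisson_coincidence n) z) (at z)"
  using holomorphic_higher_deriv[OF holomorphic_poisson_coincidence[of n UNIV] open_UNIV, of j]
  by (simp add: holomorphic_derivI)

lemma higher_deriv_poisson_coincidence_ode:
  fixes z :: complex
  shows "z * (deriv ^^ Suc (Suc j)) (poisson_coincidence n) z
    + (of_nat j + 1 + 4 * of_nat n * z) * (deriv ^^ Suc j) (poisson_coincidence n) z
    + 2 * of_nat n * (2 * of_nat j + 1) * (deriv ^^ j) (poisson_coincidence n) z = 0"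
proof (induction j arbitrary: z)
  case 0
  then show ?case using poisson_coincidence_ode[of z n] by simp
next
  case (Suc j)
  define f where "f = (\<lambda>k. (deriv ^^ k) (poisson_coincidence n))"
  have f: "(f k has_field_derivative f (Suc k) z) (at z)" for k z
    unfolding f_def by (rule DERIV_higher_deriv_poisson_coincidence)
  let ?E = "\<lambda>z. z * f (Suc (Suc j)) z + (of_nat j + 1 + 4 * of_nat n * z) * f (Suc j) z
    + 2 * of_nat n * (2 * of_nat j + 1) * f j z"
  have "(?E has_field_derivative
      z * f (Suc (Suc (Suc j))) z + (of_nat (Suc j) + 1 + 4 * of_nat n * z) * f (Suc (Suc j)) z
      + 2 * of_nat n * (2 * of_nat (Suc j) + 1) * f (Suc j) z) (at z)"
    by (rule derivative_eq_intros f refl | simp add: algebra_simps)+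
  moreover have "?E = (\<lambda>_. 0)"
    using Suc.IH by (auto simp: f_def simp del: funpow.simps)
  ultimately have "((\<lambda>_. 0) has_field_derivative
      z * f (Suc (Suc (Suc j))) z + (of_nat (Suc j) + 1 + 4 * of_nat n * z) * f (Suc (Suc j)) z
      + 2 * of_nat n * (2 * of_nat (Suc j) + 1) * f (Suc j) z) (at z)"
    by simp
  then have "z * f (Suc (Suc (Suc j))) z
      + (of_nat (Suc j) + 1 + 4 * of_nat n * z) * f (Suc (Suc j)) z
      + 2 * of_nat n * (2 * of_nat (Suc j) + 1) * f (Suc j) z = 0"
    by (rule DERIV_unique) (rule DERIV_const)
  then show ?case unfolding f_def .
qed

lemma central_binomial_Suc:
  "(j + 1) * ((2 * Suc j) choose Suc j) = 2 * (2 * j + 1) * ((2 * j) choose j)"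
proof -
  have 1: "Suc j * (Suc (Suc (2 * j)) choose Suc j) = Suc (Suc (2 * j)) * (Suc (2 * j) choose j)"
    using Suc_times_binomial_eq[of "Suc (2 * j)" j] by (simp only: mult.commute)
  have 2: "Suc j * (Suc (2 * j) choose j) = Suc (2 * j) * (2 * j choose j)"
    using Suc_times_binomial_eq[of "2 * j" j] binomial_symmetric[of j "Suc (2 * j)"]
    by (simp add: mult.commute)
  have "Suc j * (Suc j * (Suc (Suc (2 * j)) choose Suc j))
      = Suc (Suc (2 * j)) * (Suc j * (Suc (2 * j) choose j))"
    unfolding 1 by simp
  also have "\<dots> = Suc j * (2 * (2 * j + 1) * ((2 * j) choose j))"
    unfolding 2 by simp
  finally have "Suc j * (Suc (Suc (2 * j)) choose Suc j) = 2 * (2 * j + 1) * ((2 * j) choose j)"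
    by (simp only: mult_cancel1) simp
  then show ?thesis by simp
qed

lemma higher_deriv_poisson_coincidence_0:
  "(deriv ^^ j) (poisson_coincidence n) 0 = (- of_nat n) ^ j * of_nat ((2 * j) choose j)"
proof (induction j)
  case 0
  show ?case by (simp add: poisson_coincidence_def inv_fact_sq_fun_def eval_fps_at_0 inv_fact_sq_fps_def)
next
  case (Suc j)
  let ?f = "\<lambda>k. (deriv ^^ k) (poisson_coincidence n) 0"
  have nz: "(of_nat (j + 1) :: complex) \<noteq> 0"
    by (simp only: of_nat_eq_0_iff)
  have "of_nat (j + 1) * ?f (Suc j) + 2 * of_nat n * (2 * of_nat j + 1) * ?f j = 0"
    using higher_deriv_poisson_coincidence_ode[of 0 j n] by (simp add: add_ac)
  then have "of_nat (j + 1) * ?f (Suc j) = - (2 * of_nat n * (2 * of_nat j + 1) * ?f j)"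
    by (simp only: eq_neg_iff_add_eq_0)
  also have "\<dots> = - of_nat n * of_nat (2 * (2 * j + 1)) * ?f j"
    by (simp add: algebra_simps)
  also have "\<dots> = (- of_nat n) ^ Suc j * of_nat (2 * (2 * j + 1) * ((2 * j) choose j))"
    unfolding Suc.IH by (simp only: of_nat_mult power_Suc mult_ac)
  also have "\<dots> = of_nat (j + 1) * ((- of_nat n) ^ Suc j * of_nat ((2 * Suc j) choose Suc j))"
    unfolding central_binomial_Suc[symmetric] by (simp only: of_nat_mult mult_ac)
  finally show ?case using nz mult_left_cancel by blast
qed

text \<open>
  The factor \<open>c\<close> leaves room for the normalisation at \<open>0\<close>, which plays no role here because the
  equation is linear.
\<close>
lemma confluent_heun_higher_deriv_poisson_coincidence:
  "confluent_heun_solution (of_nat n) (of_nat j + 1) 0 (of_nat j + 1 / 2)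
     (2 * of_nat n * (2 * of_nat j + 1)) UNIV
     (\<lambda>z. c * (deriv ^^ j) (poisson_coincidence n) z)"
proof -
  define f where "f = (\<lambda>k. (deriv ^^ k) (poisson_coincidence n))"
  have f: "(f k has_field_derivative f (Suc k) z) (at z)" for k z
    unfolding f_def by (rule DERIV_higher_deriv_poisson_coincidence)
  have d: "deriv (\<lambda>z. c * f k z) = (\<lambda>z. c * f (Suc k) z)" for k
    by (rule ext, rule DERIV_imp_deriv, rule DERIV_cmult, rule f)
  have f_j: "(\<lambda>z. c * (deriv ^^ j) (poisson_coincidence n) z) = (\<lambda>z. c * f j z)"
    by (simp add: f_def)
  show ?thesis
    unfolding confluent_heun_solution_def f_j
  proof (intro conjI ballI)
    show "(\<lambda>z. c * f j z) holomorphic_on UNIV"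
      using f by (intro holomorphic_intros) (auto simp: holomorphic_on_def field_differentiable_def)
    fix z :: complex assume "z \<in> UNIV - {0, 1}"
    then have z: "z \<noteq> 0" "z - 1 \<noteq> 0" by auto
    let ?N = "complex_of_nat n" and ?J = "complex_of_nat j"
    have ode: "z * f (Suc (Suc j)) z + (?J + 1 + 4 * ?N * z) * f (Suc j) z
        + 2 * ?N * (2 * ?J + 1) * f j z = 0"
      unfolding f_def by (rule higher_deriv_poisson_coincidence_ode)
    \<comment> \<open>The singularity at \<open>1\<close> is removed by a factor \<open>z - 1\<close> in the numerator.\<close>
    have "4 * ?N * (?J + 1 / 2) * z - 2 * ?N * (2 * ?J + 1) = 2 * ?N * (2 * ?J + 1) * (z - 1)"
      by (simp add: algebra_simps)
    then have frac: "(4 * ?N * (?J + 1 / 2) * z - 2 * ?N * (2 * ?J + 1)) / (z * (z - 1))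
        = 2 * ?N * (2 * ?J + 1) / z"
      using z by simp
    have "c * f (Suc (Suc j)) z + (4 * ?N + (?J + 1) / z + 0 / (z - 1)) * (c * f (Suc j) z)
          + 2 * ?N * (2 * ?J + 1) / z * (c * f j z)
        = c / z * (z * f (Suc (Suc j)) z + (?J + 1 + 4 * ?N * z) * f (Suc j) z
          + 2 * ?N * (2 * ?J + 1) * f j z)"
      using z by (simp add: field_simps)
    also have "\<dots> = 0" by (simp add: ode)
    finally show "deriv (deriv (\<lambda>z. c * f j z)) z
        + (4 * ?N + (?J + 1) / z + 0 / (z - 1)) * deriv (\<lambda>z. c * f j z) z
        + (4 * ?N * (?J + 1 / 2) * z - 2 * ?N * (2 * ?J + 1)) / (z * (z - 1)) * (c * f j z) = 0"
      unfolding d frac .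
  qed
qed

section \<open>Derivatives along the half-line\<close>

text \<open>
  A function that is real on the half-line has real derivative there, including the
  endpoint: the difference quotients along the half-line are real.
\<close>
lemma deriv_halfline_eq_complex_deriv:
  fixes F :: "complex \<Rightarrow> complex" and f :: "real \<Rightarrow> real"
  assumes F: "(F has_field_derivative D) (at (of_real x))" and x: "x \<ge> 0"
    and eq: "\<And>y. y \<ge> 0 \<Longrightarrow> F (of_real y) = of_real (f y)"
  shows "D = of_real (deriv_halfline f x)"
proof -
  have "x islimpt {0..}"
    unfolding islimpt_approachable_le
  proof (intro allI impI)
    fix e :: real assume "e > 0"
    then show "\<exists>y\<in>{0..}. y \<noteq> x \<and> dist y x \<le> e"
      using x by (intro bexI[of _ "x + e"]) (auto simp: dist_real_def)
  qed
  then have nontriv: "at x within {0..} \<noteq> bot"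
    by (simp add: trivial_limit_within)
  have "((\<lambda>y. F (of_real y)) has_vector_derivative D) (at x within {0..})"
    using has_vector_derivative_real_field[OF F, of "{0..}"] by simp
  then have D: "((\<lambda>y. complex_of_real (f y)) has_vector_derivative D) (at x within {0..})"
    by (rule has_vector_derivative_transform[rotated 2]) (use x eq in auto)
  have "(f has_vector_derivative Re D) (at x within {0..})"
    using bounded_linear.has_vector_derivative[OF bounded_linear_Re D] by simp
  then have Re: "deriv_halfline f x = Re D"
    unfolding deriv_halfline_def by (rule vector_derivative_within[OF nontriv])
  have "((\<lambda>_. 0 :: real) has_vector_derivative Im D) (at x within {0..})"
    using bounded_linear.has_vector_derivative[OF bounded_linear_Im D] by simp
  then have "Im D = 0"
    using vector_derivative_unique_within[OF nontriv _ has_vector_derivative_const] by blast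
  with Re show ?thesis by (simp add: complex_eq_iff)
qed

lemma higher_deriv_halfline_K:
  assumes "x \<ge> 0"
  shows "(deriv ^^ j) (poisson_coincidence n) (of_real x) = of_real ((deriv_halfline ^^ j) (K n) x)"
  using assms
proof (induction j arbitrary: x)
  case 0
  then show ?case by (simp add: poisson_coincidence_of_real)
next
  case (Suc j)
  have "(deriv ^^ Suc j) (poisson_coincidence n) (of_real x)
      = of_real (deriv_halfline ((deriv_halfline ^^ j) (K n)) x)"
    by (rule deriv_halfline_eq_complex_deriv
        [OF DERIV_higher_deriv_poisson_coincidence Suc.prems Suc.IH])
  then show ?case by simp
qed

section \<open>The confluent Heun function as a derivative of the index of coincidence\<close>

theorem theorem4p1:
  fixes n j :: nat and x :: real
  assumes "n \<ge> 1" and "x \<ge> 0"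
  shows "HC (of_nat n) (of_nat j + 1) 0 (of_nat j + 1 / 2) (2 * of_nat n * (2 * of_nat j + 1)) (of_real x)
         = of_real ((- real n) powi (- int j) * inverse (real ((2 * j) choose j))
                    * (deriv_halfline ^^ j) (K n) x)"
proof -
  define c where "c = (- real n) powi (- int j) * inverse (real ((2 * j) choose j))"
  have "complex_of_real c * (deriv ^^ j) (poisson_coincidence n) 0
      = of_real (c * ((- real n) ^ j * real ((2 * j) choose j)))"
    by (simp add: higher_deriv_poisson_coincidence_0)
  also have "c * ((- real n) ^ j * real ((2 * j) choose j)) = 1"
  proof -
    have "(2 * j) choose j \<noteq> 0" by simp
    then show ?thesis
      using assms(1) by (simp add: c_def power_int_minus field_simps)
  qed
  finally have 1: "complex_of_real c * (deriv ^^ j) (poisson_coincidence n) 0 = 1" by simp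
  have "of_nat j + 1 \<notin> (\<int>\<^sub>\<le>\<^sub>0 :: complex set)"
    using of_nat_in_nonpos_Ints_iff[where 'a = complex, of "Suc j"] by (simp add: add.commute)
  then have "HC (of_nat n) (of_nat j + 1) 0 (of_nat j + 1 / 2)
      (2 * of_nat n * (2 * of_nat j + 1)) (of_real x)
      = complex_of_real c * (deriv ^^ j) (poisson_coincidence n) (of_real x)"
    using confluent_heun_higher_deriv_poisson_coincidence 1 by (rule HC_eq_entire_solution)
  also have "\<dots> = of_real (c * (deriv_halfline ^^ j) (K n) x)"
    using higher_deriv_halfline_K[OF assms(2)] by simp
  finally show ?thesis by (simp add: c_def)
qed

end
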